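(* For $i=1,\dots,r$, let the mappings $\eta_i:\mathbb{R}^{(N+1)n}\times\mathbb{R}^{Nm}\to\mathbb{R}$ be measurable and convex, let $\varphi_i:\mathbb{R}\to\mathbb{R}$ be measurable, monotone nondecreasing and convex, let $\beta_i>0$, and let $J_i(\theta)=\mathbb{E}[\varphi_i(\eta_i(\bar x_\theta,\bar u_\theta))]$. Assume that the $J_i(\theta)$ are finite for all $\theta\in\Theta$. Then each $J_i(\theta)$ is a convex function of $\theta$ and $\mathcal{F}_{\rm ICC}=\{\theta\in\Theta:\ J_i(\theta)\le\beta_i,\ i=1,\dots,r\}$ is a convex set. As a consequence, if $V:\mathbb{R}^{(N+1)n}\times\mathbb{R}^{Nm}\to\mathbb{R}$ is measurable and convex and $\mathbb{E}[V(\bar x_\theta,\bar u_\theta)]$ is finite for all $\theta\in\Theta$, then $$\inf_{\theta\in\Theta}\ \mathbb{E}[V(\bar x_\theta,\bar u_\theta)]\quad\text{subject to}\quad J_i(\theta)\le\beta_i,\ i=1,\dots,r,$$ is a convex optimization problem.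
   Context: Let $n,m,N,r\ge 1$ be integers, $A\in\mathbb{R}^{n\times n}$, $B\in\mathbb{R}^{n\times m}$, $x_0\in\mathbb{R}^n$, and let $w(0),\dots,w(N-1)$ be $\mathbb{R}^n$-valued random vectors on a probability space $(\Omega,\mathfrak{F},\mathbb{P})$ (arbitrary joint distribution), stacked into $\bar w\in\mathbb{R}^{Nn}$. The linear system $x(t+1)=Ax(t)+Bu(t)+w(t)$, $x(0)=x_0$, is written over $t=0,\dots,N$ as $\bar x=\bar A x_0+\bar B\bar u+\bar D\bar w$, where $\bar x\in\mathbb{R}^{(N+1)n}$ stacks $x(0),\dots,x(N)$ and $\bar u\in\mathbb{R}^{Nm}$ stacks $u(0),\dots,u(N-1)$; $\bar A$ stacks $I_n,A,\dots,A^N$; $\bar B$ is the $(N+1)n\times Nm$ matrix whose $n\times m$ block in position $(t,s)$, $0\le t\le N$, $0\le s\le N-1$, is $A^{t-1-s}B$ if $s<t$ and $0$ otherwise; $\bar D$ is the $(N+1)n\times Nn$ matrix whose $n\times n$ block $(t,s)$ is $A^{t-1-s}$ if $s<t$ and $0$ otherwise. $\Theta$ is the linear space of parameters $\theta=(\bar G,\bar d)$ with $\bar d\in\mathbb{R}^{Nm}$ and $\bar G\in\mathbb{R}^{Nm\times Nn}$ strictly block lower triangular (its $m\times n$ block $(t,i)$, $0\le t,i\le N-1$, vanishes whenever $i\ge t$). For $\theta\in\Theta$, $\bar u_\theta=\bar G\bar w+\bar d$ and $\bar x_\theta=\bar A x_0+\bar B(\bar G\bar w+\bar d)+\bar D\bar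 w$. An optimization problem is convex if its objective is a convex function of the decision variable and its feasible set is convex. *)

theory Defs
  imports "HOL-Probability.Probability"
begin

(* The horizon N is CARD('N) for an arbitrary finite linearly ordered type 'N.
   Its elements, listed in increasing order, are the stages 0, ..., N-1, while
   'N option indexes the N+1 sampling times 0, ..., N: None is time 0 and
   Some s is the time reached after stage s. *)

definition stage :: "'N::{finite,linorder} \<Rightarrow> nat"
  where "stage s = card {..<s}"

definition time :: "'N::{finite,linorder} option \<Rightarrow> nat"
  where "time t = (case t of None \<Rightarrow> 0 | Some s \<Rightarrow> Suc (stage s))"

lemma stage_less_iff: "stage s < stage t \<longleftrightarrow> s < t"
proof -
  have *: "stage s < stage t" if "s < t" for s t :: 'a
    unfolding stage_def using that by (intro psubset_card_mono) auto
  show ?thesis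
    using *[of s t] *[of t s] by (cases s t rule: linorder_cases) auto
qed

lemma inj_stage: "inj stage"
  by (metis injI linorder_neq_iff stage_less_iff)

lemma stage_less_card: "stage (s :: 'N::{finite,linorder}) < CARD('N)"
  unfolding stage_def by (rule psubset_card_mono) auto

lemma bij_stage: "bij_betw (stage :: 'N::{finite,linorder} \<Rightarrow> nat) UNIV {..<CARD('N)}"
proof -
  have "range (stage :: 'N \<Rightarrow> nat) = {..<CARD('N)}"
    by (intro card_subset_eq) (auto simp: card_image inj_stage stage_less_card)
  then show ?thesis
    by (simp add: bij_betw_def inj_stage)
qed

lemma bij_time: "bij_betw (time :: 'N::{finite,linorder} option \<Rightarrow> nat) UNIV {..CARD('N)}"
proof -
  have inj: "inj (time :: 'N option \<Rightarrow> nat)"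
    by (rule injI) (auto simp: time_def inj_eq[OF inj_stage] split: option.splits)
  have "time t \<le> CARD('N)" for t :: "'N option"
    by (auto simp: time_def Suc_le_eq stage_less_card split: option.splits)
  then have "range (time :: 'N option \<Rightarrow> nat) = {..CARD('N)}"
    by (intro card_subset_eq) (auto simp: card_image inj)
  then show ?thesis
    by (simp add: bij_betw_def inj)
qed


definition stack :: "('t::finite \<Rightarrow> real^'k) \<Rightarrow> real^('t \<times> 'k)"
  where "stack v = (\<chi> p. v (fst p) $ snd p)"

definition block_matrix :: "('t::finite \<Rightarrow> 's::finite \<Rightarrow> real^'l^'k) \<Rightarrow> real^('s \<times> 'l)^('t \<times> 'k)"
  where "block_matrix F = (\<chi> p q. F (fst p) (fst q) $ snd p $ snd q)"

(* The power notation of the type of square matrices is entrywise, hence this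
   power with respect to the matrix product. *)
primrec matrix_power :: "real^'n^'n \<Rightarrow> nat \<Rightarrow> real^'n^'n" where
  "matrix_power A 0 = mat 1"
| "matrix_power A (Suc k) = A ** matrix_power A k"

definition A_bar :: "real^'n^'n \<Rightarrow> real^'n^('N::{finite,linorder} option \<times> 'n)"
  where "A_bar A = (\<chi> p. matrix_power A (time (fst p)) $ snd p)"

definition B_bar ::
    "real^'n^'n \<Rightarrow> real^'m^'n \<Rightarrow> real^('N::{finite,linorder} \<times> 'm)^('N option \<times> 'n)"
  where "B_bar A B = block_matrix (\<lambda>t s.
    if stage s < time t then matrix_power A (time t - 1 - stage s) ** B else 0)"

definition D_bar :: "real^'n^'n \<Rightarrow> real^('N::{finite,linorder} \<times> 'n)^('N option \<times> 'n)"
  where "D_bar A = block_matrix (\<lambda>t s.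
    if stage s < time t then matrix_power A (time t - 1 - stage s) else 0)"

lemma stack_add: "stack (\<lambda>t. f t + g t) = stack f + stack g"
  by (simp add: stack_def vec_eq_iff)

lemma block_matrix_mult_stack:
  "block_matrix F *v stack v = stack (\<lambda>t. \<Sum>s\<in>UNIV. F t s *v v s)"
  by (simp add: vec_eq_iff block_matrix_def stack_def matrix_vector_mult_def
      flip: UNIV_Times_UNIV sum.cartesian_product split: prod.splits)
     (simp add: sum.cartesian_product case_prod_beta)

(* The stacked equation is the solution of the linear recursion. *)
lemma stacked_dynamics:
  fixes x :: "nat \<Rightarrow> real^'n" and w :: "'N::{finite,linorder} \<Rightarrow> real^'n"
    and u :: "'N \<Rightarrow> real^'m"
  assumes x0: "x 0 = x0"
    and step: "\<And>s. x (Suc (stage s)) = A *v x (stage s) + B *v u s + w s"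
  shows "stack (\<lambda>t. x (time t)) = A_bar A *v x0 + B_bar A B *v stack u + D_bar A *v stack w"
proof -
  let ?P = "matrix_power A"
  let ?v = "\<lambda>s. B *v u s + w s"
  have sol: "x k = ?P k *v x0 + (\<Sum>s | stage s < k. ?P (k - 1 - stage s) *v ?v s)"
    if "k \<le> CARD('N)" for k
    using that
  proof (induction k)
    case 0
    then show ?case by (simp add: x0)
  next
    case (Suc k)
    then have "k \<in> range (stage :: 'N \<Rightarrow> nat)"
      using bij_stage[where 'N='N] by (simp add: bij_betw_def)
    then obtain s0 :: 'N where s0: "stage s0 = k"
      by blast
    have split: "{s. stage s < Suc k} = insert s0 {s. stage s < k}"
      using s0 by (auto simp: less_Suc_eq dest: injD[OF inj_stage])
    have shift: "?P (k - stage s) *v y = A *v (?P (k - 1 - stage s) *v y)"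
      if "stage s < k" for s :: 'N and y
    proof -
      have "k - stage s = Suc (k - 1 - stage s)"
        using that by simp
      then show ?thesis
        by (simp add: matrix_vector_mul_assoc)
    qed
    have "x (Suc k) = A *v x k + ?v s0"
      using step[of s0] s0 by simp
    also have "\<dots> = ?P (Suc k) *v x0
        + (\<Sum>s | stage s < k. A *v (?P (k - 1 - stage s) *v ?v s)) + ?v s0"
      using Suc by (simp add: matrix_vector_right_distrib matrix_vector_mul_assoc
          linear_sum[OF matrix_vector_mul_linear])
    also have "(\<Sum>s | stage s < k. A *v (?P (k - 1 - stage s) *v ?v s))
        = (\<Sum>s | stage s < k. ?P (k - stage s) *v ?v s)"
      by (intro sum.cong) (auto simp: shift)
    finally show ?case
      using s0 by (simp add: split)
  qed
  have "x (time t) = ?P (time t) *v x0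
      + (\<Sum>s\<in>UNIV. (if stage s < time t then ?P (time t - 1 - stage s) ** B else 0) *v u s)
      + (\<Sum>s\<in>UNIV. (if stage s < time t then ?P (time t - 1 - stage s) else 0) *v w s)"
    for t :: "'N option"
  proof -
    have "time t \<le> CARD('N)"
      using bij_time[where 'N='N] by (auto simp: bij_betw_def)
    moreover have "(\<Sum>s | stage s < time t. ?P (time t - 1 - stage s) *v ?v s)
      = (\<Sum>s\<in>UNIV. (if stage s < time t then ?P (time t - 1 - stage s) ** B else 0) *v u s
          + (if stage s < time t then ?P (time t - 1 - stage s) else 0) *v w s)"
      by (rule sum.mono_neutral_cong_left)
         (auto simp: matrix_vector_right_distrib matrix_vector_mul_assoc)
    ultimately show ?thesis
      by (simp add: sol sum.distrib add.assoc)
  qed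
  moreover have "A_bar A *v x0 = stack (\<lambda>t::'N option. ?P (time t) *v x0)"
    by (simp add: A_bar_def stack_def matrix_vector_mult_def vec_eq_iff)
  ultimately show ?thesis
    by (simp add: B_bar_def D_bar_def block_matrix_mult_stack flip: stack_add)
qed


type_synonym ('N, 'n, 'm) policy =
  "(real^('N \<times> 'n)^('N \<times> 'm)) \<times> (real^('N \<times> 'm))"

definition Theta :: "('N::{finite,linorder}, 'n::finite, 'm::finite) policy set"
  where "Theta = {(G, d). \<forall>t i. t \<le> i \<longrightarrow> (\<forall>j k. G $ (t, j) $ (i, k) = 0)}"

lemma subspace_Theta: "subspace Theta"
  by (auto simp: subspace_def Theta_def zero_prod_def)

definition u_bar ::
    "('N \<Rightarrow> '\<Omega> \<Rightarrow> real^'n) \<Rightarrow> ('N::{finite,linorder}, 'n, 'm::finite) policy \<Rightarrow> '\<Omega> \<Rightarrow> real^('N \<times> 'm)"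
  where "u_bar w \<theta> \<omega> = fst \<theta> *v stack (\<lambda>s. w s \<omega>) + snd \<theta>"

definition x_bar ::
    "real^'n^'n \<Rightarrow> real^'m^'n \<Rightarrow> real^'n \<Rightarrow> ('N \<Rightarrow> '\<Omega> \<Rightarrow> real^'n) \<Rightarrow>
     ('N::{finite,linorder}, 'n, 'm) policy \<Rightarrow> '\<Omega> \<Rightarrow> real^('N option \<times> 'n)"
  where "x_bar A B x0 w \<theta> \<omega> =
    A_bar A *v x0 + B_bar A B *v u_bar w \<theta> \<omega> + D_bar A *v stack (\<lambda>s. w s \<omega>)"

definition expected_cost ::
    "'\<Omega> measure \<Rightarrow> real^'n^'n \<Rightarrow> real^'m^'n \<Rightarrow> real^'n \<Rightarrow> ('N \<Rightarrow> '\<Omega> \<Rightarrow> real^'n) \<Rightarrow>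
     ((real^('N option \<times> 'n)) \<times> (real^('N \<times> 'm)) \<Rightarrow> real) \<Rightarrow>
     ('N::{finite,linorder}, 'n, 'm) policy \<Rightarrow> real"
  where "expected_cost M A B x0 w V \<theta> = (\<integral>\<omega>. V (x_bar A B x0 w \<theta> \<omega>, u_bar w \<theta> \<omega>) \<partial>M)"

(* The Bochner integral is 0 for non-integrable functions, so finiteness of an
   expectation has to be expressed by integrability. *)
definition finite_expected_cost ::
    "'\<Omega> measure \<Rightarrow> real^'n^'n \<Rightarrow> real^'m^'n \<Rightarrow> real^'n \<Rightarrow> ('N \<Rightarrow> '\<Omega> \<Rightarrow> real^'n) \<Rightarrow>
     ((real^('N option \<times> 'n)) \<times> (real^('N \<times> 'm)) \<Rightarrow> real) \<Rightarrow>
     ('N::{finite,linorder}, 'n, 'm) policy \<Rightarrow> bool"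
  where "finite_expected_cost M A B x0 w V \<theta> \<longleftrightarrow>
    integrable M (\<lambda>\<omega>. V (x_bar A B x0 w \<theta> \<omega>, u_bar w \<theta> \<omega>))"

definition F_ICC ::
    "nat \<Rightarrow> (nat \<Rightarrow> ('N::{finite,linorder}, 'n::finite, 'm::finite) policy \<Rightarrow> real) \<Rightarrow> (nat \<Rightarrow> real) \<Rightarrow>
     ('N, 'n, 'm) policy set"
  where "F_ICC r J \<beta> = {\<theta>\<in>Theta. \<forall>i\<in>{1..r}. J i \<theta> \<le> \<beta> i}"

(* The problem of minimizing f over the points of D satisfying the constraint C. *)
definition convex_optimization_problem ::
    "'a::real_vector set \<Rightarrow> ('a \<Rightarrow> real) \<Rightarrow> ('a \<Rightarrow> bool) \<Rightarrow> bool"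
  where "convex_optimization_problem D f C \<longleftrightarrow> convex_on D f \<and> convex {x\<in>D. C x}"

end

theory Submission
  imports Defs
begin

text \<open>
  For a fixed noise realization \<open>\<omega>\<close>, the stacked input is a linear function and the stacked state
  an affine function of the policy \<open>\<theta> = (G, d)\<close>: feeding back the disturbance instead of the state
  keeps the closed loop free of products of decision variables (\<open>u_bar_linear\<close>, \<open>x_bar_affine\<close>). A convex
  cost composed with an affine map is convex in \<open>\<theta>\<close>, one realization at a time, and the
  expectation preserves convexity because it is monotone and linear on integrable functions
  (\<open>convex_on_integral\<close>). This gives \<open>convex_on_expected_cost\<close>, which covers the objective
  directly. It covers the constraint functions too, since a nondecreasing convex function of a
  convex function is convex (\<open>convex_on_mono_comp\<close>). The feasible set is an intersection of
  sublevel sets of convex functions, hence convex (\<open>convex_sublevel\<close>).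
\<close>

lemma convex_on_mono_comp:
  fixes g :: "real \<Rightarrow> real"
  assumes g: "convex_on UNIV g" "mono g" and f: "convex_on S f"
  shows "convex_on S (g \<circ> f)"
proof (rule convex_onI)
  fix t :: real and x y
  assume t: "0 < t" "t < 1" and xy: "x \<in> S" "y \<in> S"
  have "f ((1 - t) *\<^sub>R x + t *\<^sub>R y) \<le> (1 - t) * f x + t * f y"
    using convex_onD[OF f] t xy by simp
  then have "g (f ((1 - t) *\<^sub>R x + t *\<^sub>R y)) \<le> g ((1 - t) * f x + t * f y)"
    by (rule monoD[OF g(2)])
  also have "\<dots> \<le> (1 - t) * g (f x) + t * g (f y)"
    using convex_onD[OF g(1), of t "f x" "f y"] t by simp
  finally show "(g \<circ> f) ((1 - t) *\<^sub>R x + t *\<^sub>R y) \<le> (1 - t) * (g \<circ> f) x + t * (g \<circ> f) y"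
    by simp
qed (use f in \<open>simp add: convex_on_imp_convex\<close>)

lemma convex_sublevel:
  assumes f: "convex_on S f"
  shows "convex {x\<in>S. f x \<le> c}"
proof (rule convexI)
  fix x y and a b :: real
  assume xy: "x \<in> {x\<in>S. f x \<le> c}" "y \<in> {x\<in>S. f x \<le> c}"
    and ab: "0 \<le> a" "0 \<le> b" "a + b = 1"
  then have "f (a *\<^sub>R x + b *\<^sub>R y) \<le> max (f x) (f y)"
    by (intro convex_lower[OF f]) auto
  with xy ab show "a *\<^sub>R x + b *\<^sub>R y \<in> {x\<in>S. f x \<le> c}"
    using convexD[OF convex_on_imp_convex[OF f], of x y a b] by auto
qed

lemma convex_on_integral:
  assumes S: "convex S"
    and convex: "\<And>\<omega>. \<omega> \<in> space M \<Longrightarrow> convex_on S (\<lambda>x. f x \<omega>)"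
    and integrable: "\<And>x. x \<in> S \<Longrightarrow> integrable M (f x)"
  shows "convex_on S (\<lambda>x. \<integral>\<omega>. f x \<omega> \<partial>M)"
proof (rule convex_onI)
  fix t :: real and x y
  assume t: "0 < t" "t < 1" and xy: "x \<in> S" "y \<in> S"
  have "(1 - t) *\<^sub>R x + t *\<^sub>R y \<in> S"
    using S t xy by (simp add: convexD)
  then have "(\<integral>\<omega>. f ((1 - t) *\<^sub>R x + t *\<^sub>R y) \<omega> \<partial>M) \<le> (\<integral>\<omega>. (1 - t) * f x \<omega> + t * f y \<omega> \<partial>M)"
    using integrable xy t by (intro integral_mono) (auto intro: convex_onD[OF convex])
  also have "\<dots> = (1 - t) * (\<integral>\<omega>. f x \<omega> \<partial>M) + t * (\<integral>\<omega>. f y \<omega> \<partial>M)"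
    using integrable xy by simp
  finally show "(\<integral>\<omega>. f ((1 - t) *\<^sub>R x + t *\<^sub>R y) \<omega> \<partial>M)
      \<le> (1 - t) * (\<integral>\<omega>. f x \<omega> \<partial>M) + t * (\<integral>\<omega>. f y \<omega> \<partial>M)" .
qed (rule S)

lemma u_bar_linear:
  "u_bar w (a *\<^sub>R \<theta> + b *\<^sub>R \<theta>') \<omega> = a *\<^sub>R u_bar w \<theta> \<omega> + b *\<^sub>R u_bar w \<theta>' \<omega>"
  by (simp add: u_bar_def matrix_vector_mult_add_rdistrib scaleR_matrix_vector_assoc scaleR_add_right)

text \<open>
  The two terms of \<open>x_bar\<close> that are independent of the policy are reproduced by a combination
  of two policies because its weights add up to one.
\<close>

lemma x_bar_affine:
  assumes "a + b = 1"
  shows "x_bar A B x0 w (a *\<^sub>R \<theta> + b *\<^sub>R \<theta>') \<omega>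
    = a *\<^sub>R x_bar A B x0 w \<theta> \<omega> + b *\<^sub>R x_bar A B x0 w \<theta>' \<omega>"
proof -
  have b: "b = 1 - a"
    using assms by simp
  show ?thesis
    unfolding x_bar_def u_bar_linear b
    by (simp add: matrix_vector_right_distrib matrix_vector_mult_scaleR algebra_simps)
qed

lemma convex_on_expected_cost:
  assumes S: "convex S" and V: "convex_on UNIV V"
    and finite: "\<And>\<theta>. \<theta> \<in> S \<Longrightarrow> finite_expected_cost M A B x0 w V \<theta>"
  shows "convex_on S (expected_cost M A B x0 w V)"
  unfolding expected_cost_def
proof (rule convex_on_integral[OF S])
  show "convex_on S (\<lambda>\<theta>. V (x_bar A B x0 w \<theta> \<omega>, u_bar w \<theta> \<omega>))" for \<omega>
  proof (rule convex_onI[OF _ S])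
    fix t :: real and \<theta> \<theta>'
    assume "0 < t" "t < 1"
    then show "V (x_bar A B x0 w ((1 - t) *\<^sub>R \<theta> + t *\<^sub>R \<theta>') \<omega>, u_bar w ((1 - t) *\<^sub>R \<theta> + t *\<^sub>R \<theta>') \<omega>)
        \<le> (1 - t) * V (x_bar A B x0 w \<theta> \<omega>, u_bar w \<theta> \<omega>)
          + t * V (x_bar A B x0 w \<theta>' \<omega>, u_bar w \<theta>' \<omega>)"
      using convex_onD[OF V, of t "(x_bar A B x0 w \<theta> \<omega>, u_bar w \<theta> \<omega>)"
          "(x_bar A B x0 w \<theta>' \<omega>, u_bar w \<theta>' \<omega>)"]
      by (simp add: x_bar_affine u_bar_linear)
  qed
qed (use finite in \<open>simp add: finite_expected_cost_def\<close>)

theorem proposition12: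
  fixes M :: "'\<Omega> measure"
    and A :: "real^'n^'n" and B :: "real^'m^'n" and x0 :: "real^'n"
    and w :: "'N::{finite,linorder} \<Rightarrow> '\<Omega> \<Rightarrow> real^'n"
    and r :: nat
    and \<eta> :: "nat \<Rightarrow> (real^('N option \<times> 'n)) \<times> (real^('N \<times> 'm)) \<Rightarrow> real"
    and \<phi> :: "nat \<Rightarrow> real \<Rightarrow> real"
    and \<beta> :: "nat \<Rightarrow> real"
    and J :: "nat \<Rightarrow> ('N, 'n, 'm) policy \<Rightarrow> real"
  assumes "prob_space M"
    and "\<And>s. w s \<in> borel_measurable M"
    and "r \<ge> 1"
    and "\<And>i. i \<in> {1..r} \<Longrightarrow> \<eta> i \<in> borel_measurable borel"
    and "\<And>i. i \<in> {1..r} \<Longrightarrow> convex_on UNIV (\<eta> i)"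
    and "\<And>i. i \<in> {1..r} \<Longrightarrow> \<phi> i \<in> borel_measurable borel"
    and "\<And>i. i \<in> {1..r} \<Longrightarrow> mono (\<phi> i)"
    and "\<And>i. i \<in> {1..r} \<Longrightarrow> convex_on UNIV (\<phi> i)"
    and "\<And>i. i \<in> {1..r} \<Longrightarrow> \<beta> i > 0"
    and "\<And>i \<theta>. i \<in> {1..r} \<Longrightarrow> \<theta> \<in> Theta \<Longrightarrow> finite_expected_cost M A B x0 w (\<phi> i \<circ> \<eta> i) \<theta>"
    and "\<And>i \<theta>. J i \<theta> = expected_cost M A B x0 w (\<phi> i \<circ> \<eta> i) \<theta>"
  shows "(\<forall>i\<in>{1..r}. convex_on Theta (J i)) \<and>
    convex (F_ICC r J \<beta>) \<and>
    (\<forall>V. V \<in> borel_measurable borel \<and> convex_on UNIV V \<and>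
        (\<forall>\<theta>\<in>Theta. finite_expected_cost M A B x0 w V \<theta>) \<longrightarrow>
      convex_optimization_problem Theta (expected_cost M A B x0 w V)
        (\<lambda>\<theta>. \<forall>i\<in>{1..r}. J i \<theta> \<le> \<beta> i))"
proof -
  have J: "J i = expected_cost M A B x0 w (\<phi> i \<circ> \<eta> i)" for i
    using assms(11) by blast
  have Theta: "convex (Theta :: ('N, 'n, 'm) policy set)"
    by (simp add: subspace_Theta subspace_imp_convex)
  have convex_J: "convex_on Theta (J i)" if "i \<in> {1..r}" for i
    unfolding J using that assms
    by (intro convex_on_expected_cost Theta convex_on_mono_comp)
  have "F_ICC r J \<beta> = Theta \<inter> (\<Inter>i\<in>{1..r}. {\<theta>\<in>Theta. J i \<theta> \<le> \<beta> i})"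
    by (auto simp: F_ICC_def)
  then have feasible: "convex (F_ICC r J \<beta>)"
    by (simp only:) (intro convex_Int Theta convex_INT convex_sublevel convex_J)
  have objective: "convex_on Theta (expected_cost M A B x0 w V)"
    if "convex_on UNIV V" "\<forall>\<theta>\<in>Theta. finite_expected_cost M A B x0 w V \<theta>" for V
    using that by (intro convex_on_expected_cost Theta) auto
  show ?thesis
    unfolding convex_optimization_problem_def
    using convex_J feasible objective by (simp add: F_ICC_def)
qed

end
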